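(* Let $0<q<1$ and $0<\delta<1$, and let $\varphi$ be an analytic function on $H(\delta)=\{z\in\mathbb{C}:\Re(z)\ge-\delta\}$. Suppose that there are $A<\pi$ and $P,C\in\mathbb{R}$ such that $|\varphi(v+iw)|<Ce^{Pv+A|w|}$ for all $v+iw\in H(\delta)$, and that $\varphi$ is $\frac{2i\pi}{\mathrm{Log}\, q}$-periodic. Let $f$ be the function on $(0,\infty)$ given by $$f(x)=\sum_{k=0}^\infty \varphi(k)(-x)^k$$ for small $x>0$ and extended to $(0,\infty)$ as explained in the context. Then for all $s$ with $0<\Re(s)<\delta$, $$\int_0^\infty x^{s-1}f(x)\,d_qx=\frac{\Gamma_q(s)\Gamma_q(1-s)}{K_q(s)}\,\varphi(-s).$$
   Context: $\mathrm{Log}$ is the natural logarithm and $q^s=e^{s\,\mathrm{Log}\,q}$. For $a\in\mathbb{C}$, $(a;q)_\infty=\prod_{k=0}^\infty(1-aq^k)$, and $(a_1,a_2;q)_\infty=(a_1;q)_\infty(a_2;q)_\infty$. The $q$-gamma function is $\Gamma_q(s)=\frac{(q;q)_\infty}{(q^s;q)_\infty}(1-q)^{1-s}$. Also $K_q(s)=\frac{(-q,-1;q)_\infty}{(-q^s,-q^{1-s};q)_\infty}$. Jackson's $q$-integral is $\int_0^\infty g(x)\,d_qx=(1-q)\sum_{n=-\infty}^\infty g(q^n)q^n$, so $\int_0^\infty x^{s-1}f(x)\,d_qx=(1-q)\sum_{n=-\infty}^{\infty}f(q^n)q^{ns}$. Extension of $f$: under the growth condition the power series converges for $0<x<e^{-P}$,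 and its sum extends (Hardy, via Mellin inversion) to a real-analytic function on $(0,\infty)$, namely $f(x)=\frac{1}{2\pi i}\int_{c-i\infty}^{c+i\infty}\frac{\pi}{\sin(\pi s)}\varphi(-s)x^{-s}\,ds$ for any $0<c<\delta$. *)

theory Defs
  imports "HOL-Complex_Analysis.Complex_Analysis"
begin

definition qpoch_inf :: "complex \<Rightarrow> real \<Rightarrow> complex" where
  "qpoch_inf a q = (\<Prod>k. 1 - a * of_real q ^ k)"

definition q_Gamma :: "real \<Rightarrow> complex \<Rightarrow> complex" where
  "q_Gamma q s =
     qpoch_inf (of_real q) q / qpoch_inf (of_real q powr s) q * of_real (1 - q) powr (1 - s)"

definition q_K :: "real \<Rightarrow> complex \<Rightarrow> complex" where
  "q_K q s =
     (qpoch_inf (- of_real q) q * qpoch_inf (- 1) q) /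
     (qpoch_inf (- (of_real q powr s)) q * qpoch_inf (- (of_real q powr (1 - s))) q)"

text \<open>Jackson's q-integral over the positive half-line. As a relation it records that the
  bilateral series converges (absolutely, by the meaning of \<^const>\<open>has_sum\<close> on complex numbers)
  and that the integral has the given value.\<close>

definition has_jackson_integral :: "real \<Rightarrow> (real \<Rightarrow> complex) \<Rightarrow> complex \<Rightarrow> bool" where
  "has_jackson_integral q g I \<longleftrightarrow>
     (\<exists>S. ((\<lambda>n::int. g (q powi n) * of_real (q powi n)) has_sum S) UNIV \<and> I = of_real (1 - q) * S)"

definition closed_right_half_plane :: "real \<Rightarrow> complex set" where
  "closed_right_half_plane \<delta> = {z. Re z \<ge> - \<delta>}"

text \<open>The integral from \<open>c - i\<infinity>\<close> to \<open>c + i\<infinity>\<close>; the factor \<^term>\<open>\<i>\<close> comes from the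
  parametrisation \<open>s = c + i t\<close>.\<close>

definition vertical_line_integral :: "real \<Rightarrow> (complex \<Rightarrow> complex) \<Rightarrow> complex" where
  "vertical_line_integral c g = \<i> * (LINT t|lborel. g (Complex c t))"

definition inverse_mellin :: "(complex \<Rightarrow> complex) \<Rightarrow> real \<Rightarrow> real \<Rightarrow> complex" where
  "inverse_mellin \<phi> c x =
     1 / (2 * of_real pi * \<i>) *
     vertical_line_integral c
       (\<lambda>s. of_real pi / sin (of_real pi * s) * \<phi> (- s) * of_real x powr (- s))"

end

theory Submission imports Defs "HOL-Probability.Sinc_Integral" begin

text \<open>
  The periodicity of \<open>\<phi>\<close> says that \<open>\<phi>\<close> is a function of \<open>w = q\<^sup>z\<close> on a punctured disc, and the growth
  condition excludes an essential singularity at \<open>w = 0\<close>. Hence \<open>\<phi>\<close> is an absolutely convergent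
  sum of exponentials, \<open>\<phi> z = (\<Sum>m. b m q\<^bsup>(m - M) z\<^esup>)\<close>, on the open half-plane
  (theorem \<open>periodic_exponential_expansion\<close>). The claim is linear in \<open>\<phi>\<close>, so the proof
  reduces to a single exponential, and after rescaling to the constant function 1.

  For \<open>\<phi> = 1\<close> the inverse Mellin transform is \<open>1 / (1 + x)\<close> (\<open>integral_mellin_kernel\<close>): shifting
  the line of integration by 1 to the left multiplies the integral by \<open>- x\<close> and crosses the simple
  pole at 0. Rescaling and summing over \<open>m\<close> gives
  \<open>f x = (\<Sum>m. b m / (1 + x q\<^bsup>m - M\<^esup>))\<close> for all \<open>x > 0\<close> (\<open>inverse_mellin_expansion\<close>).

  The Jackson integral of \<open>x\<^bsup>s - 1\<^esup> / (1 + x)\<close> is \<open>1 - q\<close> times the bilateral series of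
  \<open>q\<^bsup>n s\<^esup> / (1 + q\<^sup>n)\<close> over all integers \<open>n\<close>. Its product formula is a case of Ramanujan's
  \<open>\<^sub>1\<psi>\<^sub>1\<close> summation (\<open>ramanujan_bilateral_sum\<close>). It is proved here as the limit of a partial
  fraction expansion of a finite product, and its value is exactly the quotient of
  \<open>q_Gamma\<close> and \<open>q_K\<close> in the claim. Multiplying \<open>x\<close> by \<open>q\<^bsup>m - M\<^esup>\<close> shifts
  the index \<open>n\<close> and produces the factor \<open>q\<^bsup>- (m - M) s\<^esup>\<close>; summed against \<open>b m\<close>, these
  factors restore \<open>\<phi> (- s)\<close> (\<open>jackson_sum_of_exponential_series\<close>).
\<close>

section \<open>A bilateral series with a product formula\<close>

text \<open>As a function of \<^term>\<open>b\<close> the product is rational with simple poles at the points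
  \<open>1 / u i\<close> and tends to \<^term>\<open>x ^ card S\<close> at infinity; the sum collects its principal parts.
  The induction stays inside a field: adjoining a new node \<open>v\<close> multiplies both sides by
  \<open>(1 - b x v) / (1 - b v)\<close>. In its product with an old summand, the factor attached to the old pole
  is exactly the missing factor of the old coefficient, while the contributions to the new pole
  add up to the induction hypothesis at \<open>b = 1 / v\<close>. Hence \<^term>\<open>b\<close> must stay arbitrary.\<close>

lemma partial_fraction_expansion:
  fixes u :: "'a \<Rightarrow> 'b :: field"
  assumes "finite S" "inj_on u S" "\<And>i. i \<in> S \<Longrightarrow> u i \<noteq> 0" "\<And>i. i \<in> S \<Longrightarrow> b * u i \<noteq> 1"
  shows "(\<Prod>i\<in>S. (1 - b * x * u i) / (1 - b * u i)) =
         x ^ card S + (\<Sum>k\<in>S. (1 - x) * (\<Prod>i\<in>S-{k}. (1 - x * (u i / u k)) / (1 - u i / u k))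
                                   / (1 - b * u k))"
  using assms
proof (induction S arbitrary: b rule: finite_induct)
  case empty
  then show ?case by simp
next
  case (insert a S)
  define c where "c k = (1 - x) * (\<Prod>i\<in>S-{k}. (1 - x * (u i / u k)) / (1 - u i / u k))" for k
  have ua: "u a \<noteq> 0" "1 - b * u a \<noteq> 0" using insert.prems by auto
  have ne: "u k \<noteq> u a" if "k \<in> S" for k
    using that insert.prems(1) insert.hyps by (auto simp: inj_on_def)
  have IH: "(\<Prod>i\<in>S. (1 - b' * x * u i) / (1 - b' * u i)) = x ^ card S + (\<Sum>k\<in>S. c k / (1 - b' * u k))"
    if "\<And>i. i \<in> S \<Longrightarrow> b' * u i \<noteq> 1" for b'
    unfolding c_def by (rule insert.IH) (use insert.prems that in auto)
  have IHb: "(\<Prod>i\<in>S. (1 - b * x * u i) / (1 - b * u i)) = x ^ card S + (\<Sum>k\<in>S. c k / (1 - b * u k))"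
    by (rule IH) (use insert.prems in auto)
  have "(\<Prod>i\<in>S. (1 - 1 / u a * x * u i) / (1 - 1 / u a * u i)) =
          x ^ card S + (\<Sum>k\<in>S. c k / (1 - 1 / u a * u k))"
    by (rule IH) (use ne ua in \<open>auto simp: field_simps\<close>)
  then have IHa: "(\<Prod>i\<in>S. (1 - x * (u i / u a)) / (1 - u i / u a)) =
          x ^ card S + (\<Sum>k\<in>S. c k / (1 - u k / u a))"
    by (simp add: mult.commute)
  have old: "(1 - x) * (\<Prod>i\<in>insert a S - {k}. (1 - x * (u i / u k)) / (1 - u i / u k)) =
             c k * ((1 - x * (u a / u k)) / (1 - u a / u k))" if "k \<in> S" for k
  proof -
    have "insert a S - {k} = insert a (S - {k})" using that insert.hyps by auto
    then show ?thesis using insert.hyps by (simp add: c_def)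
  qed
  have old_sum: "(\<Sum>k\<in>S. (1 - x) * (\<Prod>i\<in>insert a S - {k}. (1 - x * (u i / u k)) / (1 - u i / u k)) / (1 - b * u k)) =
      (\<Sum>k\<in>S. c k * ((1 - x * (u a / u k)) / (1 - u a / u k)) / (1 - b * u k))"
    by (rule sum.cong) (simp_all only: old)
  have split: "(1 - b * x * u a) / (1 - b * u a) * (c k / (1 - b * u k)) =
      (1 - x) * (c k / (1 - u k / u a)) / (1 - b * u a)
      + c k * ((1 - x * (u a / u k)) / (1 - u a / u k)) / (1 - b * u k)" if "k \<in> S" for k
  proof -
    define v w where "v = u a" and "w = u k"
    have vw: "v \<noteq> 0" "w \<noteq> 0" "v - w \<noteq> 0" "w - v \<noteq> 0" "1 - b * v \<noteq> 0" "1 - b * w \<noteq> 0"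
      using that ne[OF that] insert.prems(2,3) ua by (auto simp: v_def w_def)
    have 1: "1 - w / v = (v - w) / v" "(1 - x * (v / w)) / (1 - v / w) = (w - x * v) / (w - v)"
      using vw by (auto simp: divide_simps)
    have 2: "(w - x * v) / (w - v) = (x * v - w) / (v - w)"
      by (metis minus_diff_eq minus_divide_divide)
    have "(1 - b * x * v) / (1 - b * v) * (1 / (1 - b * w)) =
      (1 - x) * (1 / (1 - w / v)) / (1 - b * v) + ((1 - x * (v / w)) / (1 - v / w)) / (1 - b * w)"
      unfolding 1 2 using vw by (simp add: divide_simps) (simp add: algebra_simps)
    then have "c k * ((1 - b * x * v) / (1 - b * v) * (1 / (1 - b * w))) =
      c k * ((1 - x) * (1 / (1 - w / v)) / (1 - b * v) + ((1 - x * (v / w)) / (1 - v / w)) / (1 - b * w))"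
      by simp
    then show ?thesis unfolding v_def w_def by (simp add: algebra_simps)
  qed
  have pow: "(1 - b * x * u a) / (1 - b * u a) * x ^ card S =
      x * x ^ card S + (1 - x) * x ^ card S / (1 - b * u a)"
    using ua by (simp add: divide_simps) (simp add: algebra_simps)
  have sums: "(\<Sum>k\<in>S. (1 - b * x * u a) / (1 - b * u a) * (c k / (1 - b * u k))) =
      (1 - x) * (\<Sum>k\<in>S. c k / (1 - u k / u a)) / (1 - b * u a)
      + (\<Sum>k\<in>S. c k * ((1 - x * (u a / u k)) / (1 - u a / u k)) / (1 - b * u k))"
    unfolding sum_distrib_left sum_divide_distrib sum.distrib[symmetric]
    by (rule sum.cong[OF HOL.refl split])
  have "(\<Prod>i\<in>insert a S. (1 - b * x * u i) / (1 - b * u i)) =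
     (1 - b * x * u a) / (1 - b * u a) * x ^ card S +
     (\<Sum>k\<in>S. (1 - b * x * u a) / (1 - b * u a) * (c k / (1 - b * u k)))"
    using insert.hyps by (simp add: IHb distrib_left sum_distrib_left)
  also have "\<dots> = x ^ card (insert a S) + (1 - x) * (x ^ card S + (\<Sum>k\<in>S. c k / (1 - u k / u a))) / (1 - b * u a)
      + (\<Sum>k\<in>S. c k * ((1 - x * (u a / u k)) / (1 - u a / u k)) / (1 - b * u k))"
    unfolding pow sums using insert.hyps by (simp add: distrib_left add_divide_distrib)
  also have "\<dots> = x ^ card (insert a S) + (\<Sum>k\<in>insert a S. (1 - x) * (\<Prod>i\<in>insert a S-{k}. (1 - x * (u i / u k)) / (1 - u i / u k))
                                   / (1 - b * u k))"
    unfolding sum.insert[OF insert.hyps] old_sum using insert.hyps by (simp add: IHa[symmetric])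
  finally show ?case .
qed

text \<open>Tannery's theorem over an arbitrary index set, as dominated convergence for the counting
  measure. Below, the index set is \<int> and the \<^term>\<open>s n\<close> are truncations.\<close>

lemma has_sum_dominated_convergence:
  fixes s :: "nat \<Rightarrow> 'a \<Rightarrow> 'b :: {banach, second_countable_topology}"
  assumes w: "w summable_on A"
    and bound: "\<And>n k. k \<in> A \<Longrightarrow> norm (s n k) \<le> w k"
    and lim: "\<And>k. k \<in> A \<Longrightarrow> (\<lambda>n. s n k) \<longlonglongrightarrow> f k"
    and sums: "\<And>n. (s n has_sum S n) A" and S: "S \<longlonglongrightarrow> L"
  shows "(f has_sum L) A"
proof -
  have wnn: "0 \<le> w k" if "k \<in> A" for k using bound[OF that] by (meson norm_ge_zero order_trans)
  have "(\<lambda>k. norm (w k)) summable_on A" using w wnn by (simp cong: summable_on_cong)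
  then have wi: "integrable (count_space A) w"
    using abs_summable_equivalent[of w A] unfolding abs_summable_on_def by simp
  have si: "integrable (count_space A) (s n)" for n
    by (rule integrable_dominated_convergence2[where s = "\<lambda>n. s n" and f = f and w = w])
       (use wi lim bound in \<open>auto simp: AE_count_space\<close>)
  have fi: "integrable (count_space A) f"
    by (rule integrable_dominated_convergence[where s = "\<lambda>n. s n" and w = w])
       (use wi lim bound in \<open>auto simp: AE_count_space\<close>)
  have "(\<lambda>n. integral\<^sup>L (count_space A) (s n)) \<longlonglongrightarrow> integral\<^sup>L (count_space A) f"
    by (rule integral_dominated_convergence[where w = w])
       (use wi lim bound in \<open>auto simp: AE_count_space\<close>)
  moreover have "integral\<^sup>L (count_space A) g = infsum g A" "g summable_on A"
    if "integrable (count_space A) g" for g :: "'a \<Rightarrow> 'b"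
  proof -
    have "Infinite_Set_Sum.abs_summable_on g A"
      using that by (simp add: Infinite_Set_Sum.abs_summable_on_def)
    then show "integral\<^sup>L (count_space A) g = infsum g A" "g summable_on A"
      using infsetsum_infsum[of g A] abs_summable_equivalent[of g A] abs_summable_summable[of g A]
      by (simp_all add: infsetsum_def)
  qed
  ultimately have "(\<lambda>n. infsum (s n) A) \<longlonglongrightarrow> infsum f A" "f summable_on A"
    using si fi by auto
  moreover have "infsum (s n) A = S n" for n using sums by (simp add: infsumI)
  ultimately have "infsum f A = L" "f summable_on A" using S LIMSEQ_unique by auto
  then show ?thesis by auto
qed

lemma qpoch_inf_tendsto:
  assumes "0 < q" "q < 1"
  shows "(\<lambda>n. \<Prod>k<n. 1 - a * of_real q ^ k) \<longlonglongrightarrow> qpoch_inf a q"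
    and "convergent_prod (\<lambda>k. 1 - a * of_real q ^ k)"
proof -
  have "summable (\<lambda>k. norm a * q ^ k)"
    using assms by (intro summable_mult summable_geometric) auto
  then have "summable (\<lambda>k. norm ((1 - a * of_real q ^ k) - 1))"
    using assms by (simp add: norm_mult norm_power)
  then show conv: "convergent_prod (\<lambda>k. 1 - a * of_real q ^ k)"
    by (intro abs_convergent_prod_imp_convergent_prod summable_imp_abs_convergent_prod)
  then show "(\<lambda>n. \<Prod>k<n. 1 - a * of_real q ^ k) \<longlonglongrightarrow> qpoch_inf a q"
    unfolding qpoch_inf_def
    by (subst filterlim_sequentially_Suc[symmetric]) (simp add: convergent_prod_LIMSEQ lessThan_Suc_atMost del: prod.lessThan_Suc)
qed

lemma qpoch_inf_nonzero:
  assumes "0 < q" "q < 1" "norm a < 1"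
  shows "qpoch_inf a q \<noteq> 0"
  unfolding qpoch_inf_def
proof (rule prodinf_nonzero)
  show "convergent_prod (\<lambda>k. 1 - a * of_real q ^ k)" using qpoch_inf_tendsto assms by blast
  fix k
  have "norm (a * of_real q ^ k) < 1"
    using assms by (simp add: norm_mult norm_power) (metis less_eq_real_def mult_left_le norm_ge_zero order_le_less_trans power_le_one)
  then show "1 - a * of_real q ^ k \<noteq> 0" by force
qed

lemma qpoch_inf_step:
  assumes "0 < q" "q < 1"
  shows "qpoch_inf a q = (1 - a) * qpoch_inf (a * of_real q) q"
proof -
  have "(\<lambda>n. \<Prod>k<Suc n. 1 - a * of_real q ^ k) \<longlonglongrightarrow> qpoch_inf a q"
    using qpoch_inf_tendsto(1)[OF assms] by (rule LIMSEQ_Suc)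
  moreover have "(\<Prod>k<Suc n. 1 - a * of_real q ^ k) = (1 - a) * (\<Prod>k<n. 1 - a * of_real q * of_real q ^ k)" for n
    by (subst prod.lessThan_Suc_shift) (simp add: mult.assoc)
  moreover have "(\<lambda>n. (1 - a) * (\<Prod>k<n. 1 - a * of_real q * of_real q ^ k)) \<longlonglongrightarrow> (1 - a) * qpoch_inf (a * of_real q) q"
    by (intro tendsto_intros qpoch_inf_tendsto(1) assms)
  ultimately show ?thesis using LIMSEQ_unique by auto
qed

text \<open>Starting at exponent 1 leaves out the factor at exponent 0, which would vanish in the
  denominator for \<open>b = 1\<close>. Only \<open>b = 1\<close> and \<open>b = -1\<close> occur: the first gives the coefficients of the
  partial fraction expansion, the second the value of the product itself.\<close>

definition qpoch_ratio :: "complex \<Rightarrow> complex \<Rightarrow> complex \<Rightarrow> nat \<Rightarrow> complex" where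
  "qpoch_ratio Q y b n = (\<Prod>m=1..n. (1 - b * y * Q ^ m) / (1 - b * Q ^ m))"

lemma qpoch_ratio_tendsto:
  assumes "0 < q" "q < 1" "norm b = 1"
  shows "qpoch_ratio (of_real q) y b \<longlonglongrightarrow> qpoch_inf (b * y * of_real q) q / qpoch_inf (b * of_real q) q"
proof -
  have *: "(\<Prod>m=1..n. 1 - c * of_real q ^ m) = (\<Prod>k<n. 1 - c * of_real q * of_real q ^ k)" for n and c :: complex
    by (rule prod.reindex_bij_witness[of _ Suc "\<lambda>m. m - 1"]) (auto simp: mult.assoc simp flip: power_Suc)
  have "qpoch_ratio (of_real q) y b = (\<lambda>n. (\<Prod>k<n. 1 - b * y * of_real q * of_real q ^ k) /
            (\<Prod>k<n. 1 - b * of_real q * of_real q ^ k))"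
    by (rule ext) (simp only: qpoch_ratio_def prod_dividef *)
  moreover have "qpoch_inf (b * of_real q) q \<noteq> 0"
    using assms by (intro qpoch_inf_nonzero) (auto simp: norm_mult)
  ultimately show ?thesis
    using assms by (auto intro!: tendsto_divide qpoch_inf_tendsto)
qed

lemma prod_symmetric_interval:
  fixes F :: "int \<Rightarrow> 'a :: comm_monoid_mult"
  assumes "\<bar>k\<bar> \<le> int N"
  shows "(\<Prod>j\<in>{-int N..int N}-{k}. F (j - k)) =
         (\<Prod>m=1..nat (int N - k). F (int m)) * (\<Prod>m=1..nat (int N + k). F (- int m))"
proof -
  have "{-int N..int N}-{k} = {k+1..int N} \<union> {-int N..k-1}" using assms by auto
  then have "(\<Prod>j\<in>{-int N..int N}-{k}. F (j - k)) =
      (\<Prod>j\<in>{k+1..int N}. F (j - k)) * (\<Prod>j\<in>{-int N..k-1}. F (j - k))"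
    by (simp add: prod.union_disjoint)
  also have "(\<Prod>j\<in>{k+1..int N}. F (j - k)) = (\<Prod>m=1..nat (int N - k). F (int m))"
    by (rule prod.reindex_bij_witness[of _ "\<lambda>m. k + int m" "\<lambda>j. nat (j - k)"]) (use assms in auto)
  also have "(\<Prod>j\<in>{-int N..k-1}. F (j - k)) = (\<Prod>m=1..nat (int N + k). F (- int m))"
    by (rule prod.reindex_bij_witness[of _ "\<lambda>m. k - int m" "\<lambda>j. nat (k - j)"]) (use assms in auto)
  finally show ?thesis .
qed

text \<open>The indices above \<^term>\<open>k\<close> give the first ratio. For those below, pulling the negative powers of
  \<^term>\<open>Q\<close> out of numerator and denominator turns \<open>1 - b x Q\<^sup>-\<^sup>m\<close> into a multiple of
  \<open>1 - b Q\<^sup>m / x\<close>; this uses \<open>1 / b = b\<close> and leaves a factor \<^term>\<open>x\<close> for each index.\<close>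

lemma prod_symmetric_interval_qpoch_ratio:
  assumes "Q \<noteq> 0" "x \<noteq> 0" "\<bar>k\<bar> \<le> int N" "b = 1 \<or> b = -1"
  shows "(\<Prod>j\<in>{-int N..int N}-{k}. (1 - b * x * Q powi (j - k)) / (1 - b * Q powi (j - k))) =
         x ^ nat (int N + k) * qpoch_ratio Q x b (nat (int N - k)) * qpoch_ratio Q (1/x) b (nat (int N + k))"
proof -
  have reflect: "(1 - b * x * Q powi (- int m)) / (1 - b * Q powi (- int m)) =
      x * ((1 - b * (1/x) * Q ^ m) / (1 - b * Q ^ m))" for m
  proof -
    define P where "P = Q powi (- int m)"
    have "P * Q ^ m = 1" using assms(1) by (simp add: P_def power_int_minus)
    then have eqs: "1 - b * x * P = (- b * P) * (x * (1 - b * (1/x) * Q ^ m))"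
      "1 - b * P = (- b * P) * (1 - b * Q ^ m)"
      using assms(2,4) by (auto simp: field_simps)
    have "- b * P \<noteq> 0" using assms by (auto simp: P_def)
    then show ?thesis
      unfolding P_def[symmetric] eqs by (subst mult_divide_mult_cancel_left) simp_all
  qed
  show ?thesis
    unfolding prod_symmetric_interval[OF assms(3), of "\<lambda>j. (1 - b * x * Q powi j) / (1 - b * Q powi j)"]
    unfolding reflect prod.distrib by (simp add: qpoch_ratio_def mult_ac)
qed

text \<open>The terms are at most \<open>r\<^sup>n\<close> for \<open>n \<ge> 0\<close>, and at most \<open>(q / r)\<^sup>-\<^sup>n\<close> for \<open>n < 0\<close> because the
  denominator is then at least \<open>q\<^sup>n\<close>.\<close>

lemma summable_bilateral:
  fixes r q :: real
  assumes "0 < q" "q < r" "r < 1"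
  shows "(\<lambda>n::int. r powi n / (1 + q powi n)) summable_on UNIV"
proof -
  let ?f = "\<lambda>n::int. r powi n / (1 + q powi n)"
  have "(\<lambda>n. ?f (int n)) summable_on UNIV"
  proof (rule summable_on_comparison_test[of "\<lambda>n. r ^ n"])
    show "(\<lambda>n. r ^ n) summable_on UNIV"
      using assms by (subst summable_on_UNIV_nonneg_real_iff) auto
    show "?f (int n) \<le> r ^ n" for n
    proof -
      have "0 < q ^ n" "0 < r ^ n" using assms by auto
      then show ?thesis by (simp add: power_int_of_nat divide_le_eq)
    qed
    show "0 \<le> ?f (int n)" for n using assms by (simp add: power_int_of_nat)
  qed
  then have 1: "?f summable_on range int"
    by (subst summable_on_reindex) (auto simp: o_def)
  have "(\<lambda>n. ?f (- int n)) summable_on UNIV"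
  proof (rule summable_on_comparison_test[of "\<lambda>n. (q / r) ^ n"])
    show "(\<lambda>n. (q / r) ^ n) summable_on UNIV"
      using assms by (subst summable_on_UNIV_nonneg_real_iff) auto
    show "?f (- int n) \<le> (q / r) ^ n" for n
    proof -
      have "0 < q ^ n" "0 < r ^ n" using assms by auto
      then show ?thesis using assms
        by (simp add: power_int_minus power_int_of_nat power_divide divide_simps)
    qed
    show "0 \<le> ?f (- int n)" for n using assms by (simp add: power_int_minus power_int_of_nat)
  qed
  then have 2: "?f summable_on range (\<lambda>n. - int n)"
    by (subst summable_on_reindex) (auto simp: o_def inj_on_def)
  have "(UNIV :: int set) = range int \<union> range (\<lambda>n. - int n)"
    by (auto intro: int_cases2)
  then show ?thesis using summable_on_union[OF 1 2] by simp
qed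

text \<open>The partial fraction expansion with the nodes \<open>Q\<^sup>j\<close>, \<open>-N \<le> j \<le> N\<close>, evaluated at \<open>b = -1\<close> and
  divided by \<open>x\<^sup>N\<close>. This division balances the two ends of the node set: every factor now
  has a limit as \<open>N\<close> tends to infinity, and the polynomial part \<open>x\<^sup>N\<^sup>+\<^sup>1\<close> tends to 0
  when \<open>|x| < 1\<close>.\<close>

lemma finite_bilateral_identity:
  assumes Q: "0 < q" "q < 1" and x: "x \<noteq> 0"
  defines "Q \<equiv> complex_of_real q"
  shows "(1 + x) / 2 * qpoch_ratio Q x (-1) N * qpoch_ratio Q (1/x) (-1) N =
         x ^ Suc N + (\<Sum>k\<in>{-int N..int N}. (1 - x) * x powi k / (1 + Q powi k) *
            qpoch_ratio Q x 1 (nat (int N - k)) * qpoch_ratio Q (1/x) 1 (nat (int N + k)))"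
proof -
  define S where "S = {-int N..int N}"
  have Q0: "Q \<noteq> 0" using Q by (simp add: Q_def)
  have Qr: "Q powi k = of_real (q powi k)" for k by (simp add: Q_def)
  have nz: "1 + Q powi k \<noteq> 0" for k
  proof -
    have "0 < q powi k" using Q by simp
    then have "of_real (1 + q powi k) \<noteq> (0 :: complex)" by (subst of_real_eq_0_iff) linarith
    then show ?thesis by (simp add: Qr)
  qed
  have nz1: "- (Q powi k) \<noteq> 1" for k
    using nz[of k] by (metis add.right_inverse add.commute)
  have "inj_on (\<lambda>j. Q powi j) S"
  proof (rule inj_onI)
    fix i j assume "Q powi i = Q powi j"
    then have "q powi i = q powi j" by (simp only: Qr of_real_eq_iff)
    then show "i = j" using Q power_int_strict_antimono[of q] by (metis linorder_neqE order_less_irrefl power_int_strict_decreasing)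
  qed
  then have "(\<Prod>i\<in>S. (1 - (-1) * x * Q powi i) / (1 - (-1) * Q powi i)) =
         x ^ card S + (\<Sum>k\<in>S. (1 - x) * (\<Prod>i\<in>S-{k}. (1 - x * (Q powi i / Q powi k)) / (1 - Q powi i / Q powi k))
                                   / (1 - (-1) * Q powi k))"
    by (intro partial_fraction_expansion) (use nz1 Q0 in \<open>auto simp: S_def\<close>)
  also have "(\<Prod>i\<in>S. (1 - (-1) * x * Q powi i) / (1 - (-1) * Q powi i)) =
      (1 + x) / 2 * (\<Prod>i\<in>S-{0}. (1 - (-1) * x * Q powi (i - 0)) / (1 - (-1) * Q powi (i - 0)))"
    by (subst prod.remove[of S 0]) (auto simp: S_def)
  also have "(\<Prod>i\<in>S-{0}. (1 - (-1) * x * Q powi (i - 0)) / (1 - (-1) * Q powi (i - 0))) =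
      x ^ N * qpoch_ratio Q x (-1) N * qpoch_ratio Q (1/x) (-1) N"
    unfolding S_def by (subst prod_symmetric_interval_qpoch_ratio) (use Q0 x in auto)
  also have "(\<Sum>k\<in>S. (1 - x) * (\<Prod>i\<in>S-{k}. (1 - x * (Q powi i / Q powi k)) / (1 - Q powi i / Q powi k))
                                   / (1 - (-1) * Q powi k)) =
     x ^ N * (\<Sum>k\<in>S. (1 - x) * x powi k / (1 + Q powi k) *
            qpoch_ratio Q x 1 (nat (int N - k)) * qpoch_ratio Q (1/x) 1 (nat (int N + k)))"
    unfolding sum_distrib_left
  proof (rule sum.cong)
    fix k assume "k \<in> S"
    then have k: "\<bar>k\<bar> \<le> int N" by (auto simp: S_def)
    have "(\<Prod>i\<in>S-{k}. (1 - x * (Q powi i / Q powi k)) / (1 - Q powi i / Q powi k)) =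
      (\<Prod>i\<in>S-{k}. (1 - 1 * x * Q powi (i - k)) / (1 - 1 * Q powi (i - k)))"
      using Q0 by (simp add: power_int_diff)
    also have "\<dots> = x ^ nat (int N + k) * qpoch_ratio Q x 1 (nat (int N - k)) * qpoch_ratio Q (1/x) 1 (nat (int N + k))"
      unfolding S_def by (rule prod_symmetric_interval_qpoch_ratio) (use Q0 x k in auto)
    also have "x ^ nat (int N + k) = x ^ N * x powi k"
    proof -
      have "x ^ nat (int N + k) = x powi (int N + k)" using k by (simp add: power_int_def)
      then show ?thesis using x by (simp add: power_int_add)
    qed
    finally show "(1 - x) * (\<Prod>i\<in>S-{k}. (1 - x * (Q powi i / Q powi k)) / (1 - Q powi i / Q powi k))
           / (1 - (-1) * Q powi k) =
      x ^ N * ((1 - x) * x powi k / (1 + Q powi k) *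
            qpoch_ratio Q x 1 (nat (int N - k)) * qpoch_ratio Q (1/x) 1 (nat (int N + k)))"
      by (simp add: mult_ac)
  qed simp
  also have "x ^ card S = x ^ N * x ^ Suc N"
  proof -
    have "card S = N + Suc N" by (simp add: S_def)
    then show ?thesis by (simp only: power_add)
  qed
  finally have "x ^ N * ((1 + x) / 2 * qpoch_ratio Q x (-1) N * qpoch_ratio Q (1/x) (-1) N) =
       x ^ N * (x ^ Suc N + (\<Sum>k\<in>S. (1 - x) * x powi k / (1 + Q powi k) *
            qpoch_ratio Q x 1 (nat (int N - k)) * qpoch_ratio Q (1/x) 1 (nat (int N + k))))"
    by (simp add: algebra_simps)
  moreover have "x ^ N \<noteq> 0" using x by simp
  ultimately show ?thesis unfolding S_def by (rule iffD1[OF mult_left_cancel, rotated])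
qed

text \<open>The case \<open>a = -1\<close>, \<open>b = -q\<close> of Ramanujan's bilateral summation of
  \<open>\<^sub>1\<psi>\<^sub>1\<close>, obtained as the limit of the finite identity. The annulus
  \<open>q < |x| < 1\<close> is where the bilateral series converges, and there the bounded products
  provide a summable majorant.\<close>

theorem ramanujan_bilateral_sum:
  fixes x :: complex
  assumes q: "0 < q" "q < 1" and x: "q < norm x" "norm x < 1"
  shows "((\<lambda>n::int. x powi n / (1 + of_real q powi n)) has_sum
           (qpoch_inf (of_real q) q ^ 2 * qpoch_inf (-x) q * qpoch_inf (- (of_real q / x)) q /
             (qpoch_inf x q * qpoch_inf (of_real q / x) q * qpoch_inf (-1) q * qpoch_inf (- of_real q) q))) UNIV"
proof -
  define Q where "Q = complex_of_real q"
  define R where "R = qpoch_ratio Q"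
  have x0: "x \<noteq> 0" using x q by auto
  have lim: "R y b \<longlonglongrightarrow> qpoch_inf (b * y * Q) q / qpoch_inf (b * Q) q" if "b = 1 \<or> b = -1" for y b
    unfolding R_def Q_def by (rule qpoch_ratio_tendsto) (use q that in auto)
  have bdd: "\<exists>B. \<forall>n. norm (R y 1 n) \<le> B" for y
    using convergent_imp_Bseq[of "R y 1"] lim[of 1 y] by (auto simp: convergent_def Bseq_def)
  obtain B1 B2 where B: "\<And>n. norm (R x 1 n) \<le> B1" "\<And>n. norm (R (1/x) 1 n) \<le> B2"
    using bdd by metis
  have B0: "0 \<le> B1" "0 \<le> B2" using B by (meson norm_ge_zero order_trans)+
  define G H where "G = qpoch_inf (x * Q) q / qpoch_inf Q q" and "H = qpoch_inf (Q / x) q / qpoch_inf Q q"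
  define s where "s N k = (if k \<in> {-int N..int N} then (1 - x) * x powi k / (1 + Q powi k) *
            R x 1 (nat (int N - k)) * R (1/x) 1 (nat (int N + k)) else 0)" for N :: nat and k :: int
  define w where "w k = norm (1 - x) * B1 * B2 * (norm x powi k / (1 + q powi k))" for k :: int
  have nQ: "norm (1 + Q powi k) = 1 + q powi k" for k
  proof -
    have "1 + Q powi k = of_real (1 + q powi k)" by (simp add: Q_def)
    moreover have "0 < q powi k" using q by simp
    ultimately show ?thesis by (simp only: norm_of_real)
  qed
  have "((\<lambda>k. (1 - x) * x powi k / (1 + Q powi k) * G * H) has_sum
          (1 + x) / 2 * (qpoch_inf (- (x * Q)) q / qpoch_inf (- Q) q) * (qpoch_inf (- (Q / x)) q / qpoch_inf (- Q) q)) UNIV"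
  proof (rule has_sum_dominated_convergence)
    show "w summable_on UNIV"
      unfolding w_def by (intro summable_on_cmult_right summable_bilateral) (use q x in auto)
    show "norm (s N k) \<le> w k" for N k
    proof -
      have "norm ((1 - x) * x powi k / (1 + Q powi k) * R x 1 (nat (int N - k)) * R (1/x) 1 (nat (int N + k)))
         = norm (1 - x) * (norm x powi k / (1 + q powi k)) * (norm (R x 1 (nat (int N - k))) * norm (R (1/x) 1 (nat (int N + k))))"
        by (simp add: norm_mult norm_divide norm_power_int nQ)
      also have "\<dots> \<le> norm (1 - x) * (norm x powi k / (1 + q powi k)) * (B1 * B2)"
        using B B0 q by (intro mult_left_mono mult_mono mult_nonneg_nonneg divide_nonneg_nonneg) auto
      finally have le: "norm ((1 - x) * x powi k / (1 + Q powi k) * R x 1 (nat (int N - k)) * R (1/x) 1 (nat (int N + k))) \<le> w k"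
        by (simp add: w_def mult_ac)
      moreover have "0 \<le> w k" using le norm_ge_zero order_trans by blast
      ultimately show ?thesis by (simp add: s_def)
    qed
    show "(\<lambda>N. s N k) \<longlonglongrightarrow> (1 - x) * x powi k / (1 + Q powi k) * G * H" for k
    proof (rule Lim_transform_eventually)
      have "filterlim (\<lambda>N. nat (int N + j)) at_top sequentially" for j
        unfolding filterlim_at_top eventually_sequentially
      proof
        fix Z show "\<exists>M. \<forall>n\<ge>M. Z \<le> nat (int n + j)"
          by (rule exI[of _ "Z + nat \<bar>j\<bar>"]) auto
      qed
      from this[of "-k"] this[of k]
      have "filterlim (\<lambda>N. nat (int N - k)) at_top sequentially"
           "filterlim (\<lambda>N. nat (int N + k)) at_top sequentially" by simp_all
      then show "(\<lambda>N. (1 - x) * x powi k / (1 + Q powi k) * R x 1 (nat (int N - k)) * R (1/x) 1 (nat (int N + k)))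
          \<longlonglongrightarrow> (1 - x) * x powi k / (1 + Q powi k) * G * H"
        unfolding G_def H_def using lim[of 1 x] lim[of 1 "1/x"]
        by (intro tendsto_mult tendsto_const) (auto intro: filterlim_compose)
      show "\<forall>\<^sub>F N in sequentially. (1 - x) * x powi k / (1 + Q powi k) * R x 1 (nat (int N - k)) * R (1/x) 1 (nat (int N + k)) = s N k"
        using eventually_ge_at_top[of "nat \<bar>k\<bar>"] by eventually_elim (auto simp: s_def)
    qed
    show "(s N has_sum ((1 + x) / 2 * R x (-1) N * R (1/x) (-1) N - x ^ Suc N)) UNIV" for N
    proof -
      have "(s N has_sum (\<Sum>k\<in>{-int N..int N}. s N k)) UNIV"
        by (rule has_sum_finite_neutralI[where B = "{-int N..int N}"]) (auto simp: s_def)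
      also have "(\<Sum>k\<in>{-int N..int N}. s N k) = (1 + x) / 2 * R x (-1) N * R (1/x) (-1) N - x ^ Suc N"
        unfolding R_def Q_def finite_bilateral_identity[OF q x0] add_diff_cancel_left'
        by (rule sum.cong) (simp_all add: s_def R_def Q_def)
      finally show ?thesis .
    qed
    have "(\<lambda>N. (1 + x) / 2 * R x (-1) N * R (1/x) (-1) N - x ^ Suc N) \<longlonglongrightarrow>
        (1 + x) / 2 * (qpoch_inf (- 1 * x * Q) q / qpoch_inf (- 1 * Q) q) *
        (qpoch_inf (- 1 * (1/x) * Q) q / qpoch_inf (- 1 * Q) q) - 0"
      by (intro tendsto_diff tendsto_mult tendsto_const lim LIMSEQ_Suc LIMSEQ_power_zero) (use x in auto)
    then show "(\<lambda>N. (1 + x) / 2 * R x (-1) N * R (1/x) (-1) N - x ^ Suc N) \<longlonglongrightarrow>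
        (1 + x) / 2 * (qpoch_inf (- (x * Q)) q / qpoch_inf (- Q) q) * (qpoch_inf (- (Q / x)) q / qpoch_inf (- Q) q)"
      by simp
  qed
  then have scaled: "((\<lambda>k. (1 / ((1 - x) * G * H)) * ((1 - x) * x powi k / (1 + Q powi k) * G * H)) has_sum
     (1 / ((1 - x) * G * H)) * ((1 + x) / 2 * (qpoch_inf (- (x * Q)) q / qpoch_inf (- Q) q) * (qpoch_inf (- (Q / x)) q / qpoch_inf (- Q) q))) UNIV"
    by (rule has_sum_cmult_right)
  have nz: "qpoch_inf Q q \<noteq> 0" "qpoch_inf (-Q) q \<noteq> 0" "qpoch_inf (x * Q) q \<noteq> 0" "qpoch_inf (Q / x) q \<noteq> 0"
    "1 - x \<noteq> 0"
  proof -
    have "norm x * q < 1 * 1" using q x by (intro mult_strict_mono) auto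
    then have "norm Q < 1" "norm (- Q) < 1" "norm (x * Q) < 1" "norm (Q / x) < 1"
      using q x x0 by (simp_all add: Q_def norm_mult norm_divide divide_less_eq)
    then show "qpoch_inf Q q \<noteq> 0" "qpoch_inf (-Q) q \<noteq> 0" "qpoch_inf (x * Q) q \<noteq> 0"
      "qpoch_inf (Q / x) q \<noteq> 0"
      by (simp_all only: qpoch_inf_nonzero[OF q] not_False_eq_True)
    show "1 - x \<noteq> 0" using x by auto
  qed
  then have GH: "G \<noteq> 0" "H \<noteq> 0" by (auto simp: G_def H_def)
  have term_eq: "(1 / ((1 - x) * G * H)) * ((1 - x) * x powi k / (1 + Q powi k) * G * H) = x powi k / (1 + Q powi k)" for k
    using nz GH by simp
  have "qpoch_inf x q = (1 - x) * qpoch_inf (x * Q) q" "qpoch_inf (-x) q = (1 + x) * qpoch_inf (- (x * Q)) q"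
    "qpoch_inf (-1) q = 2 * qpoch_inf (- Q) q"
    using qpoch_inf_step[OF q, of x] qpoch_inf_step[OF q, of "-x"] qpoch_inf_step[OF q, of "-1"] by (simp_all add: Q_def)
  then have sum_eq: "(1 / ((1 - x) * G * H)) * ((1 + x) / 2 * (qpoch_inf (- (x * Q)) q / qpoch_inf (- Q) q) * (qpoch_inf (- (Q / x)) q / qpoch_inf (- Q) q))
    = qpoch_inf Q q ^ 2 * qpoch_inf (-x) q * qpoch_inf (- (Q / x)) q /
             (qpoch_inf x q * qpoch_inf (Q / x) q * qpoch_inf (-1) q * qpoch_inf (- Q) q)"
    using nz by (simp add: G_def H_def power2_eq_square mult_ac)
  show ?thesis using scaled unfolding term_eq sum_eq unfolding Q_def .
qed

section \<open>The inverse Mellin transform of exponential sums\<close>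

text \<open>The integrand of the inverse Mellin transform for the constant function 1; all other
  exponentials reduce to it by rescaling \<^term>\<open>y\<close>.\<close>

definition mellin_kernel :: "real \<Rightarrow> complex \<Rightarrow> complex" where
  "mellin_kernel y s = of_real pi / sin (of_real pi * s) * of_real y powr (- s)"

text \<open>Comparison with a quadratic is all that is needed from the exponential decay of \<open>1 / sin\<close> along
  vertical lines, because \<open>1 / (1 + t\<^sup>2)\<close> is integrable.\<close>

lemma one_plus_square_le_cosh: "1 + t\<^sup>2 \<le> 2 * cosh (pi * t :: real)"
proof -
  have "1 + \<bar>t\<bar> * pi + (\<bar>t\<bar> * pi)^2/2 \<le> exp (\<bar>t\<bar> * pi)"
    by (rule exp_lower_Taylor_quadratic) simp
  moreover have "1 + t\<^sup>2 \<le> 1 + \<bar>t\<bar> * pi + (\<bar>t\<bar> * pi)^2/2"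
  proof -
    have "t\<^sup>2 * 2 \<le> t\<^sup>2 * pi\<^sup>2"
      using pi_gt3 power_mono[of 3 pi 2] by (intro mult_left_mono) auto
    moreover have "0 \<le> \<bar>t\<bar> * pi" by simp
    ultimately show ?thesis unfolding power_mult_distrib power2_abs by linarith
  qed
  moreover have "exp (\<bar>t\<bar> * pi) \<le> 2 * cosh (\<bar>t\<bar> * pi)"
    by (simp add: cosh_def)
  moreover have "cosh (\<bar>t\<bar> * pi) = cosh (pi * t)"
    by (cases "t \<ge> 0") (simp_all add: mult.commute)
  ultimately show ?thesis by linarith
qed

text \<open>Both bounds come from
  \<open>|sin z|\<^sup>2 = sin\<^sup>2 (Re z) cosh\<^sup>2 (Im z) + cos\<^sup>2 (Re z) sinh\<^sup>2 (Im z)\<close>. The first serves on vertical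
  lines away from the zeros; the second is uniform in the real part and serves on horizontal segments.\<close>

lemma norm_sin_ge:
  "\<bar>sin (Re z)\<bar> * cosh (Im z) \<le> norm (sin z)" "\<bar>sinh (Im z)\<bar> \<le> norm (sin z)"
proof -
  have "sin z = Complex (sin (Re z) * cosh (Im z)) (cos (Re z) * sinh (Im z))"
    by (simp add: complex_eq_iff Re_sin Im_sin cosh_def sinh_def field_simps)
  then have *: "norm (sin z) ^ 2 = (sin (Re z) * cosh (Im z))^2 + (cos (Re z) * sinh (Im z))^2"
    by (simp add: cmod_power2)
  have "(\<bar>sin (Re z)\<bar> * cosh (Im z)) ^ 2 \<le> norm (sin z) ^ 2"
    unfolding * by (simp add: power_mult_distrib)
  then show "\<bar>sin (Re z)\<bar> * cosh (Im z) \<le> norm (sin z)" by (rule power2_le_imp_le) simp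
  have "norm (sin z) ^ 2 = (sin (Re z))^2 * (1 + (sinh (Im z))^2) + (cos (Re z))^2 * (sinh (Im z))^2"
    by (simp only: * power_mult_distrib cosh_square_eq add.commute)
  also have "\<dots> = (sin (Re z))^2 + ((sin (Re z))^2 + (cos (Re z))^2) * (sinh (Im z))^2"
    by (simp only: distrib_left distrib_right mult_1_right add.assoc)
  also have "\<dots> = (sin (Re z))^2 + (sinh (Im z))^2" by simp
  finally have "\<bar>sinh (Im z)\<bar> ^ 2 \<le> norm (sin z) ^ 2" by simp
  then show "\<bar>sinh (Im z)\<bar> \<le> norm (sin z)" by (rule power2_le_imp_le) simp
qed

lemma sin_pi_times_eq_0_iff:
  "sin (of_real pi * s :: complex) = 0 \<longleftrightarrow> s \<in> \<int>"
proof
  assume "sin (of_real pi * s) = 0"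
  then obtain n :: int where "of_real pi * s = of_real (of_int n * pi)" by (auto simp: sin_eq_0)
  then have "s = of_int n" by (simp add: mult.commute)
  then show "s \<in> \<int>" by simp
next
  assume "s \<in> \<int>"
  then obtain n :: int where "s = of_int n" by (rule Ints_cases)
  then show "sin (of_real pi * s) = 0" by (auto simp: sin_eq_0 mult.commute)
qed

lemma norm_mellin_kernel_le:
  assumes "y > 0" "sin (pi * c) \<noteq> 0"
  shows "norm (mellin_kernel y (Complex c t)) \<le>
           2 * pi * y powr (-c) / \<bar>sin (pi * c)\<bar> * inverse (1 + t\<^sup>2)"
proof -
  have "\<bar>sin (pi * c)\<bar> * ((1 + t\<^sup>2) / 2) \<le> \<bar>sin (pi * c)\<bar> * cosh (pi * t)"
    using one_plus_square_le_cosh[of t] by (intro mult_left_mono) auto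
  also have "\<dots> \<le> norm (sin (of_real pi * Complex c t))"
    using norm_sin_ge(1)[of "of_real pi * Complex c t"] by simp
  finally have le: "\<bar>sin (pi * c)\<bar> * ((1 + t\<^sup>2) / 2) \<le> norm (sin (of_real pi * Complex c t))" .
  have pos: "0 < 1 + t\<^sup>2" by (simp add: add_pos_nonneg)
  then have pos2: "0 < \<bar>sin (pi * c)\<bar> * ((1 + t\<^sup>2) / 2)"
    using assms(2) by (intro mult_pos_pos) auto
  have "norm (mellin_kernel y (Complex c t)) = pi * y powr (-c) / norm (sin (of_real pi * Complex c t))"
    using assms by (simp add: mellin_kernel_def norm_mult norm_divide norm_powr_real_powr)
  also have "\<dots> \<le> pi * y powr (-c) / (\<bar>sin (pi * c)\<bar> * ((1 + t\<^sup>2) / 2))"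
    using less_le_trans[OF pos2 le] pos pos2 assms(2) by (intro divide_left_mono[OF le] mult_pos_pos) auto
  also have "\<dots> = 2 * pi * y powr (-c) / \<bar>sin (pi * c)\<bar> * inverse (1 + t\<^sup>2)"
    using pos assms by (simp add: field_simps)
  finally show ?thesis .
qed

lemma integrable_inverse_one_plus_square: "integrable lborel (\<lambda>t::real. inverse (1 + t\<^sup>2))"
  using integrable_inverse_1_plus_square by (simp add: set_integrable_def einterval_def)

lemma mellin_kernel_holomorphic:
  assumes "y > 0"
  shows "mellin_kernel y holomorphic_on - \<int>"
  unfolding mellin_kernel_def using assms
  by (auto intro!: holomorphic_intros simp: sin_pi_times_eq_0_iff)

lemma continuous_on_mellin_kernel_vertical:
  assumes "y > 0" "sin (pi * c) \<noteq> 0"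
  shows "continuous_on A (\<lambda>t. mellin_kernel y (Complex c t))"
proof -
  have "Complex c t \<notin> \<int>" for t
  proof
    assume "Complex c t \<in> \<int>"
    then obtain n where "Complex c t = of_int n" by (rule Ints_cases)
    then have "c = of_int n" by (simp add: complex_eq_iff)
    then show False using assms(2) by (simp add: mult.commute sin_zero_iff_int2)
  qed
  then show ?thesis
    by (intro continuous_on_compose2[OF holomorphic_on_imp_continuous_on[OF mellin_kernel_holomorphic[OF assms(1)]]])
       (auto intro!: continuous_intros simp: Complex_eq)
qed

lemma integrable_mellin_kernel:
  assumes "y > 0" "sin (pi * c) \<noteq> 0"
  shows "integrable lborel (\<lambda>t. mellin_kernel y (Complex c t))"
proof (rule Bochner_Integration.integrable_bound)
  show "integrable lborel (\<lambda>t::real. 2 * pi * y powr (-c) / \<bar>sin (pi * c)\<bar> * inverse (1 + t\<^sup>2))"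
    by (intro integrable_mult_right integrable_inverse_one_plus_square)
  show "(\<lambda>t. mellin_kernel y (Complex c t)) \<in> borel_measurable lborel"
    using borel_measurable_continuous_onI[OF continuous_on_mellin_kernel_vertical[OF assms]] by simp
  show "AE t in lborel. norm (mellin_kernel y (Complex c t)) \<le>
          norm (2 * pi * y powr (-c) / \<bar>sin (pi * c)\<bar> * inverse (1 + t\<^sup>2))"
    using norm_mellin_kernel_le[OF assms] by (intro AE_I2) (force intro: order_trans[OF _ abs_ge_self])
qed

text \<open>The quasi-periodicity that makes the contour shift by 1 return the original integral, up to
  the factor \<open>- y\<close>.\<close>

lemma mellin_kernel_minus_one:
  assumes "y > 0"
  shows "mellin_kernel y (s - 1) = - of_real y * mellin_kernel y s"
proof -
  have "sin (of_real pi * (s - 1)) = - sin (of_real pi * s)"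
    by (simp add: right_diff_distrib sin_diff flip: sin_of_real cos_of_real)
  moreover have "of_real y powr (- (s - 1)) = (of_real y :: complex) * of_real y powr (- s)"
    using assms powr_add[of "of_real y :: complex" 1 "- s"] by (simp add: add.commute)
  ultimately show ?thesis by (simp add: mellin_kernel_def)
qed

lemma punctured_strip_subset:
  "{s. Re s > -1} \<inter> {s. Re s < 1} - {0} \<subseteq> - (\<int> :: complex set)"
proof (intro subsetI ComplI)
  fix s :: complex assume s: "s \<in> {s. Re s > -1} \<inter> {s. Re s < 1} - {0}" "s \<in> \<int>"
  then obtain n where n: "s = of_int n" by (auto elim: Ints_cases)
  with s(1) have "real_of_int (-1) < real_of_int n" "real_of_int n < real_of_int 1" by simp_all
  then have "n = 0" unfolding of_int_less_iff by simp
  with n s(1) show False by simp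
qed

lemma residue_mellin_kernel:
  assumes "y > 0"
  shows "residue (mellin_kernel y) 0 = 1"
proof (rule residue_simple')
  let ?S = "{s. Re s > -1} \<inter> {s. Re s < 1} :: complex set"
  show "open ?S" by (intro open_Int open_halfspace_Re_gt open_halfspace_Re_lt)
  show "mellin_kernel y holomorphic_on ?S - {0}"
    by (rule holomorphic_on_subset[OF mellin_kernel_holomorphic[OF assms] punctured_strip_subset])
  have "((\<lambda>z. sin (of_real pi * z)) has_field_derivative of_real pi) (at (0::complex))"
    by (auto intro!: derivative_eq_intros)
  then have "(\<lambda>z. sin (of_real pi * z) / z) \<midarrow>0\<rightarrow> (of_real pi :: complex)"
    by (simp add: has_field_derivative_iff)
  then have "(\<lambda>z. of_real pi / (sin (of_real pi * z) / z) * of_real y powr (- z)) \<midarrow>0\<rightarrow>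
       of_real pi / of_real pi * of_real y powr (- (0 :: complex))"
    using assms by (intro tendsto_intros) auto
  then show "(\<lambda>w. mellin_kernel y w * (w - 0)) \<midarrow>0\<rightarrow> 1"
    using assms by (simp add: mellin_kernel_def mult_ac)
qed auto

lemma mellin_kernel_vertical_limit:
  assumes "y > 0" "sin (pi * c) \<noteq> 0"
  shows "((\<lambda>T. integral {-T..T} (\<lambda>t. mellin_kernel y (Complex c t))) \<longlongrightarrow>
           (LINT t|lborel. mellin_kernel y (Complex c t))) at_top"
proof -
  let ?g = "\<lambda>t. mellin_kernel y (Complex c t)"
  have int: "integrable lborel ?g" by (rule integrable_mellin_kernel[OF assms])
  have "((\<lambda>T. LINT t|lborel. indicator {-T..T} t *\<^sub>R ?g t) \<longlongrightarrow> (LINT t|lborel. ?g t)) at_top"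
  proof (rule integral_dominated_convergence_at_top[where w = "\<lambda>t. norm (?g t)"])
    show "AE t in lborel. ((\<lambda>T. indicator {-T..T} t *\<^sub>R ?g t) \<longlongrightarrow> ?g t) at_top"
    proof (intro AE_I2 tendsto_eventually)
      fix t :: real
      show "\<forall>\<^sub>F T in at_top. indicator {-T..T} t *\<^sub>R ?g t = ?g t"
        using eventually_ge_at_top[of "\<bar>t\<bar>"] by eventually_elim (auto simp: indicator_def)
    qed
  qed (use int in \<open>auto simp: indicator_def intro!: always_eventually\<close>)
  moreover have "(LINT t|lborel. indicator {-T..T} t *\<^sub>R ?g t) = integral {-T..T} ?g" for T
  proof -
    have "set_integrable lborel {-T..T} ?g"
      unfolding set_integrable_def by (rule integrable_mult_indicator[OF _ int]) simp
    from set_borel_integral_eq_integral(2)[OF this] show ?thesis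
      by (simp add: set_lebesgue_integral_def)
  qed
  ultimately show ?thesis by simp
qed

text \<open>Let \<open>J\<close> be the integral. Integrate the kernel around rectangles with vertical sides on the
  abscissas \<open>c - 1\<close> and \<open>c\<close>. The only pole inside is 0, with residue 1, and the horizontal
  sides vanish in the limit. By quasi-periodicity the left side contributes \<open>y J\<close>, so
  \<open>(1 + y) J = 2 \<pi>\<close>. A single shift thus gives the value for every \<open>y > 0\<close>, without a residue series
  and the restriction \<open>y < 1\<close> that it would bring.\<close>

theorem integral_mellin_kernel:
  assumes y: "y > 0" and c: "0 < c" "c < 1"
  shows "(LINT t|lborel. mellin_kernel y (Complex c t)) = 2 * of_real pi / (1 + of_real y)"
proof -
  define g where "g = mellin_kernel y"
  define J where "J = (LINT t|lborel. g (Complex c t))"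
  define K where "K T = integral {-T..T} (\<lambda>t. g (Complex c t))" for T
  define a b where "a T = contour_integral (linepath (Complex (c-1) (-T)) (Complex c (-T))) g"
    and "b T = contour_integral (linepath (Complex c T) (Complex (c-1) T)) g" for T
  define S where "S = {s. Re s > -1} \<inter> {s. Re s < 1}"
  have opS: "open S" unfolding S_def by (intro open_Int open_halfspace_Re_gt open_halfspace_Re_lt)
  have convS: "convex S" unfolding S_def by (intro convex_Int convex_halfspace_Re_gt convex_halfspace_Re_lt)
  have holo: "g holomorphic_on S - {0}"
    unfolding g_def S_def
    by (rule holomorphic_on_subset[OF mellin_kernel_holomorphic[OF y] punctured_strip_subset])
  have sc: "sin (pi * c) \<noteq> 0" using c sin_gt_zero[of "pi * c"] by simp
  have rect: "a T + \<i> * K T + b T + \<i> * (of_real y * K T) = 2 * of_real pi * \<i>" if T: "T > 0" for T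
  proof -
    define p1 p2 p3 p4 where "p1 = Complex (c-1) (-T)" and "p2 = Complex c (-T)"
      and "p3 = Complex c T" and "p4 = Complex (c-1) T"
    let ?R = "rectpath p1 p3"
    have img: "path_image ?R \<subseteq> S - {0}"
      using c T by (subst path_image_rectpath) (auto simp: p1_def p3_def S_def)
    have R: "?R = linepath p1 p2 +++ linepath p2 p3 +++ linepath p3 p4 +++ linepath p4 p1"
      by (simp add: rectpath_def p1_def p2_def p3_def p4_def Let_def)
    have "contour_integral ?R g = 2 * pi * \<i> * (\<Sum>p\<in>{0}. winding_number ?R p * residue g p)"
    proof (rule Residue_theorem[OF opS convex_connected[OF convS] _ holo])
      show "\<forall>z. z \<notin> S \<longrightarrow> winding_number ?R z = 0"
        using img convS by (intro allI impI winding_number_zero_outside[of _ S]) auto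
    qed (use img in auto)
    also have "\<dots> = 2 * of_real pi * \<i>"
    proof -
      have "winding_number ?R 0 = 1"
        by (rule winding_number_rectpath) (use c T in \<open>auto simp: p1_def p3_def in_box_complex_iff\<close>)
      then show ?thesis using residue_mellin_kernel[OF y] by (simp add: g_def)
    qed
    finally have total: "contour_integral ?R g = 2 * of_real pi * \<i>" .
    have contg: "continuous_on (S - {0}) g" using holo by (rule holomorphic_on_imp_continuous_on)
    have sides: "path_image (linepath p1 p2) \<subseteq> S - {0}" "path_image (linepath p2 p3) \<subseteq> S - {0}"
       "path_image (linepath p3 p4) \<subseteq> S - {0}" "path_image (linepath p4 p1) \<subseteq> S - {0}"
      using img unfolding R by (simp_all add: path_image_join)
    have ints: "g contour_integrable_on linepath p1 p2" "g contour_integrable_on linepath p2 p3"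
       "g contour_integrable_on linepath p3 p4" "g contour_integrable_on linepath p4 p1"
      using sides by (auto intro!: contour_integrable_continuous_linepath continuous_on_subset[OF contg])
    have "contour_integral ?R g = a T + contour_integral (linepath p2 p3) g + b T + contour_integral (linepath p4 p1) g"
      unfolding R using ints by (simp add: a_def b_def p1_def p2_def p3_def p4_def contour_integrable_joinI)
    also have "contour_integral (linepath p2 p3) g = \<i> * K T"
      unfolding K_def by (rule contour_integral_linepath_same_Re) (use T in \<open>auto simp: p2_def p3_def\<close>)
    also have "contour_integral (linepath p4 p1) g = - contour_integral (linepath p1 p4) g"
      by (metis contour_integral_reverse_linepath contg continuous_on_subset sides(4) path_image_linepath)
    also have "contour_integral (linepath p1 p4) g = \<i> * integral {-T..T} (\<lambda>t. g (Complex (c-1) t))"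
      by (rule contour_integral_linepath_same_Re) (use T in \<open>auto simp: p1_def p4_def\<close>)
    also have "(\<lambda>t. g (Complex (c-1) t)) = (\<lambda>t. - of_real y * g (Complex c t))"
    proof
      fix t
      have "Complex (c-1) t = Complex c t - 1" by (simp add: complex_eq_iff)
      then show "g (Complex (c-1) t) = - of_real y * g (Complex c t)"
        using mellin_kernel_minus_one[OF y] by (simp add: g_def)
    qed
    also have "integral {-T..T} \<dots> = - of_real y * K T"
      unfolding K_def by (rule integral_mult_right)
    finally show ?thesis using total by (simp add: algebra_simps)
  qed
  \<comment> \<open>As the real part runs over an interval of length 1, \<open>y powr (- Re z)\<close> is largest at an endpoint.\<close>
  define M where "M = pi * max (y powr (-c)) (y powr (1-c))"
  have bound: "norm (g z) \<le> M / sinh (pi * T)"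
    if z: "c - 1 \<le> Re z" "Re z \<le> c" "\<bar>Im z\<bar> = T" and T: "T > 0" for z T
  proof -
    have "y powr (- Re z) \<le> max (y powr (-c)) (y powr (1-c))"
    proof (cases "y \<ge> 1")
      case True
      then have "y powr (- Re z) \<le> y powr (1-c)" using z by (intro powr_mono) auto
      then show ?thesis by simp
    next
      case False
      then have "y powr (- Re z) \<le> y powr (-c)" using z y by (intro powr_mono') auto
      then show ?thesis by simp
    qed
    moreover have "\<bar>sinh (pi * Im z)\<bar> = sinh (pi * T)"
      using z(3) T by (cases "Im z \<ge> 0") (auto simp: abs_if mult_less_0_iff)
    then have "sinh (pi * T) \<le> norm (sin (of_real pi * z))"
      using norm_sin_ge(2)[of "of_real pi * z"] by simp
    moreover have "0 < sinh (pi * T)" using T by simp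
    moreover have "norm (g z) = pi * y powr (- Re z) / norm (sin (of_real pi * z))"
      using y by (simp add: g_def mellin_kernel_def norm_mult norm_divide norm_powr_real_powr)
    ultimately show ?thesis
      unfolding M_def using y by (auto intro!: frac_le mult_left_mono simp: le_max_iff_disj)
  qed
  have M0: "0 \<le> M" using y by (simp add: M_def le_max_iff_disj)
  have horiz: "norm (contour_integral (linepath (Complex u v) (Complex u' v)) g) \<le> M / sinh (pi * T)"
    if "{u, u'} = {c-1, c}" "\<bar>v\<bar> = T" "T > 0" for u u' v T
  proof -
    have seg: "closed_segment (Complex u v) (Complex u' v) = {z. Im z = v \<and> Re z \<in> {c-1..c}}"
      using that by (auto simp: closed_segment_same_Im closed_segment_eq_real_ivl doubleton_eq_iff)
    have "norm (contour_integral (linepath (Complex u v) (Complex u' v)) g)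
        \<le> M / sinh (pi * T) * norm (Complex u' v - Complex u v)"
    proof (rule contour_integral_bound_linepath)
      have "closed_segment (Complex u v) (Complex u' v) \<subseteq> S - {0}"
        unfolding seg S_def using c that by auto
      then show "g contour_integrable_on linepath (Complex u v) (Complex u' v)"
        by (intro contour_integrable_continuous_linepath continuous_on_subset[OF holomorphic_on_imp_continuous_on[OF holo]])
      show "0 \<le> M / sinh (pi * T)" using M0 that by simp
      show "norm (g z) \<le> M / sinh (pi * T)" if "z \<in> closed_segment (Complex u v) (Complex u' v)" for z
        using that \<open>\<bar>v\<bar> = T\<close> \<open>T > 0\<close> unfolding seg by (intro bound) auto
    qed
    moreover have "norm (Complex u' v - Complex u v) = 1"
      using that(1) by (auto simp: doubleton_eq_iff cmod_def)
    ultimately show ?thesis by simp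
  qed
  have lim0: "((\<lambda>T. M / sinh (pi * T)) \<longlongrightarrow> 0) at_top"
    by (intro real_tendsto_divide_at_top[OF tendsto_const] filterlim_compose[OF sinh_real_at_top]
         filterlim_tendsto_pos_mult_at_top[OF tendsto_const] filterlim_ident) simp
  have "(a \<longlongrightarrow> 0) at_top" "(b \<longlongrightarrow> 0) at_top"
    unfolding a_def b_def
    by (rule Lim_null_comparison[OF _ lim0], use eventually_gt_at_top[of 0] in eventually_elim, rule horiz; auto)+
  moreover have "(K \<longlongrightarrow> J) at_top"
    unfolding K_def J_def g_def by (rule mellin_kernel_vertical_limit[OF y sc])
  ultimately have "((\<lambda>T. a T + \<i> * K T + b T + \<i> * (of_real y * K T)) \<longlongrightarrow> 0 + \<i> * J + 0 + \<i> * (of_real y * J)) at_top"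
    by (intro tendsto_intros)
  moreover have "((\<lambda>T. a T + \<i> * K T + b T + \<i> * (of_real y * K T)) \<longlongrightarrow> 2 * of_real pi * \<i>) at_top"
    by (rule tendsto_eventually, rule eventually_mono[OF eventually_gt_at_top[of 0] rect])
  ultimately have "0 + \<i> * J + 0 + \<i> * (of_real y * J) = 2 * of_real pi * \<i>"
    by (rule tendsto_unique[rotated]) simp
  then have "\<i> * (J * (1 + of_real y)) = \<i> * (2 * of_real pi)" by (simp add: algebra_simps)
  then have "J * (1 + of_real y) = 2 * of_real pi" by simp
  moreover have "1 + of_real y \<noteq> (0 :: complex)"
    using y by (metis add_pos_pos less_irrefl of_real_1 of_real_add of_real_eq_0_iff zero_less_one)
  ultimately show ?thesis unfolding J_def g_def by (simp add: field_simps)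
qed

lemma mellin_kernel_mult:
  assumes "x > 0" "u > 0"
  shows "mellin_kernel (x * u) s = mellin_kernel x s * of_real u powr (- s)"
  using assms by (simp add: mellin_kernel_def powr_times_real mult_ac)

text \<open>Termwise integration: multiplying the kernel by \<open>u\<^sup>-\<^sup>s\<close> amounts to replacing \<^term>\<open>x\<close> by
  \<^term>\<open>x * u\<close>, and on the line of integration \<open>|u\<^sup>-\<^sup>s|\<close> is constant, so that the integrals of the
  absolute values sum to a multiple of the given summable series.\<close>

theorem inverse_mellin_expansion:
  fixes b :: "nat \<Rightarrow> complex" and u :: "nat \<Rightarrow> real"
  assumes x: "x > 0" and c: "0 < c" "c < 1" and u: "\<And>m. u m > 0"
    and summable: "summable (\<lambda>m. norm (b m) * u m powr (- c))"
    and sums: "\<And>t. (\<lambda>m. b m * of_real (u m) powr (- Complex c t)) sums \<phi> (- Complex c t)"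
  shows "(\<lambda>m. b m / (1 + of_real (x * u m))) sums inverse_mellin \<phi> c x"
proof -
  define k where "k m t = b m * mellin_kernel (x * u m) (Complex c t)" for m t
  have sc: "sin (pi * c) \<noteq> 0" using c sin_gt_zero[of "pi * c"] by simp
  have k_eq: "k m t = mellin_kernel x (Complex c t) * (b m * of_real (u m) powr (- Complex c t))" for m t
    unfolding k_def using mellin_kernel_mult[OF x u] by simp
  have norm_k: "norm (k m t) = norm (mellin_kernel x (Complex c t)) * (norm (b m) * u m powr (- c))" for m t
    using u[of m] by (simp add: k_eq norm_mult norm_powr_real_powr)
  have k_sums: "(\<lambda>m. k m t) sums (mellin_kernel x (Complex c t) * \<phi> (- Complex c t))" for t
    unfolding k_eq by (intro sums_mult sums)
  have "(\<lambda>m. LINT t|lborel. k m t) sums (LINT t|lborel. (\<Sum>m. k m t))"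
  proof (rule sums_integral)
    show "integrable lborel (k m)" for m
      unfolding k_def using x u sc by (intro integrable_mult_right integrable_mellin_kernel) auto
    show "AE t in lborel. summable (\<lambda>m. norm (k m t))"
      unfolding norm_k by (intro AE_I2 summable_mult summable)
    show "summable (\<lambda>m. LINT t|lborel. norm (k m t))"
      unfolding norm_k by (simp add: summable_mult summable)
  qed
  moreover have "(\<Sum>m. k m t) = mellin_kernel x (Complex c t) * \<phi> (- Complex c t)" for t
    using k_sums by (rule sums_unique[symmetric])
  moreover have "(LINT t|lborel. k m t) = b m * (2 * of_real pi / (1 + of_real (x * u m)))" for m
    unfolding k_def using integral_mellin_kernel[OF _ c, of "x * u m"] x u by simp
  ultimately have "(\<lambda>m. b m * (2 * of_real pi / (1 + of_real (x * u m)))) sums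
      (LINT t|lborel. mellin_kernel x (Complex c t) * \<phi> (- Complex c t))" by simp
  then have "(\<lambda>m. 1 / (2 * of_real pi) * (b m * (2 * of_real pi / (1 + of_real (x * u m))))) sums
      (1 / (2 * of_real pi) * (LINT t|lborel. mellin_kernel x (Complex c t) * \<phi> (- Complex c t)))"
    by (rule sums_mult)
  moreover have "inverse_mellin \<phi> c x =
      1 / (2 * of_real pi) * (LINT t|lborel. mellin_kernel x (Complex c t) * \<phi> (- Complex c t))"
    by (simp add: inverse_mellin_def vertical_line_integral_def mellin_kernel_def mult_ac)
  ultimately show ?thesis by simp
qed

section \<open>Exponential expansion of periodic functions\<close>

lemma powr_of_real_powi:
  assumes "q > 0"
  shows "of_real (q powi k) powr z = (of_real q powr z :: complex) powi k"
proof -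
  have exp_form: "of_real y powr z = exp (z * of_real (ln y))" if "y > 0" for y
    using that by (simp add: powr_def Ln_of_real)
  have "of_real (q powi k) powr z = exp (z * of_real (ln (q powi k)))"
    by (rule exp_form) (use assms in simp)
  also have "\<dots> = exp (of_int k * (z * of_real (ln q)))"
    using assms by (simp add: power_int_def ln_realpow ln_inverse mult_ac)
  also have "\<dots> = (of_real q powr z) powi k"
    using assms by (simp add: powr_def Ln_of_real exp_power_int)
  finally show ?thesis .
qed

text \<open>The substitution \<open>w = q\<^sup>z\<close> maps the half-plane onto a punctured disc around 0, and
  periodicity means that \<open>\<phi>\<close> is a function of \<open>w\<close>. A period strip has bounded imaginary part, so the
  factor \<open>e\<^bsup>A|Im z|\<^esup>\<close> is harmless there and \<open>\<phi>\<close> grows at most like a power of \<open>1 / |w|\<close>. For large \<open>M\<close>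
  the function \<open>w\<^sup>M \<phi>\<close> therefore tends to 0 at the origin; the singularity is removable, and the Taylor
  series of the extension, divided by \<open>w\<^sup>M\<close>, is the expansion.\<close>

theorem periodic_exponential_expansion:
  fixes q \<delta> A P C :: real and \<phi> :: "complex \<Rightarrow> complex"
  assumes q: "0 < q" "q < 1"
    and holo: "\<phi> holomorphic_on {z. Re z > - \<delta>}"
    and growth: "\<And>z. Re z > - \<delta> \<Longrightarrow> norm (\<phi> z) \<le> C * exp (P * Re z + A * \<bar>Im z\<bar>)"
    and periodic: "\<And>z. Re z > - \<delta> \<Longrightarrow>
                   \<phi> (z + 2 * \<i> * of_real pi / of_real (ln q)) = \<phi> z"
  obtains b :: "nat \<Rightarrow> complex" and M :: nat where
    "\<And>z. Re z > - \<delta> \<Longrightarrow>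
        summable (\<lambda>m. norm (b m * of_real (q powi (int m - int M)) powr z))"
    "\<And>z. Re z > - \<delta> \<Longrightarrow>
        (\<lambda>m. b m * of_real (q powi (int m - int M)) powr z) sums \<phi> z"
proof -
  define L where "L = ln q"
  have L: "L < 0" using q by (simp add: L_def)
  define \<Lambda> where "\<Lambda> = complex_of_real L"
  have \<Lambda>0: "\<Lambda> \<noteq> 0" using L by (simp add: \<Lambda>_def)
  define T where "T = 2 * \<i> * of_real pi / \<Lambda>"
  have ReT: "Re T = 0" by (simp add: T_def \<Lambda>_def)
  have per: "\<phi> (z + T) = \<phi> z" if "Re z > - \<delta>" for z
    using periodic[OF that] by (simp add: T_def \<Lambda>_def L_def)
  have per_nat: "\<phi> (z + of_nat n * T) = \<phi> z" if "Re z > - \<delta>" for z n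
  proof (induction n)
    case (Suc n)
    have "\<phi> (z + of_nat n * T + T) = \<phi> (z + of_nat n * T)"
      by (rule per) (use that ReT in simp)
    then show ?case using Suc.IH by (simp add: algebra_simps)
  qed simp
  have per_int: "\<phi> (z + of_int n * T) = \<phi> z" if "Re z > - \<delta>" for z n
  proof (cases n rule: int_cases2)
    case (nonneg k)
    then show ?thesis using per_nat[OF that] by simp
  next
    case (nonpos k)
    have "\<phi> (z + of_int n * T + of_nat k * T) = \<phi> (z + of_int n * T)"
      by (rule per_nat) (use that ReT in simp)
    then show ?thesis using nonpos by simp
  qed
  obtain M :: nat where "P / (- L) < real M" using reals_Archimedean2 by blast
  then have M: "0 < real M + P / L" by simp
  define r where "r = exp (- \<delta> * L)"
  have r0: "r > 0" by (simp add: r_def)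
  \<comment> \<open>The principal logarithm is one choice of preimage under the substitution;
    by periodicity any other choice gives the same value.\<close>
  define G where "G w = w ^ M * \<phi> (Ln w / \<Lambda>)" for w
  have dom: "Re (w / \<Lambda>) > - \<delta>" if "exp w \<in> ball 0 r" for w
  proof -
    have "exp (Re w) < exp (- \<delta> * L)" using that by (simp add: r_def)
    then have "Re w < - \<delta> * L" by simp
    then show ?thesis using L by (simp add: \<Lambda>_def field_simps)
  qed
  have G_exp: "G (exp w) = exp w ^ M * \<phi> (w / \<Lambda>)" if "exp w \<in> ball 0 r" for w
  proof -
    have "exp (Ln (exp w)) = exp w" by simp
    then obtain n :: int where "Ln (exp w) = w + of_int (2 * n) * of_real pi * \<i>"
      unfolding exp_eq by auto
    then have "Ln (exp w) / \<Lambda> = w / \<Lambda> + of_int n * T"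
      using \<Lambda>0 by (simp add: T_def field_simps)
    then show ?thesis unfolding G_def using per_int[OF dom[OF that]] by simp
  qed
  have G_holo: "G holomorphic_on ball 0 r - {0}"
  proof -
    have comp: "(\<lambda>w. \<phi> (h w / \<Lambda>)) holomorphic_on U"
      if "h holomorphic_on U" "\<And>w. w \<in> U \<Longrightarrow> exp (h w) \<in> ball 0 r" for h U
    proof -
      have "\<phi> \<circ> (\<lambda>w. h w / \<Lambda>) holomorphic_on U"
        by (rule holomorphic_on_compose_gen[OF _ holo])
           (use that \<Lambda>0 dom in \<open>auto intro!: holomorphic_intros\<close>)
      then show ?thesis by (simp add: o_def)
    qed
    \<comment> \<open>Off the negative axis the principal logarithm is holomorphic. Off the positive axis
      the branch \<open>Ln (- w) + \<i> \<pi>\<close> is, and it yields the same function.\<close>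
    define U1 U2 where "U1 = ball (0::complex) r - \<real>\<^sub>\<le>\<^sub>0" and "U2 = ball (0::complex) r - \<real>\<^sub>\<ge>\<^sub>0"
    have open12: "open U1" "open U2"
      unfolding U1_def U2_def by (auto intro!: open_Diff closed_nonpos_Reals_complex closed_nonneg_Reals_complex)
    have nz: "w \<noteq> 0" if "w \<in> U1 \<or> w \<in> U2" for w using that by (auto simp: U1_def U2_def)
    have 1: "G holomorphic_on U1"
      unfolding G_def by (intro holomorphic_intros comp) (use nz in \<open>auto simp: U1_def intro!: holomorphic_intros\<close>)
    have "(\<lambda>w. w ^ M * \<phi> ((Ln (- w) + \<i> * of_real pi) / \<Lambda>)) holomorphic_on U2"
    proof (intro holomorphic_intros comp)
      show "- w \<notin> \<real>\<^sub>\<le>\<^sub>0" if "w \<in> U2" for w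
        using that by (auto simp: U2_def complex_nonpos_Reals_iff complex_nonneg_Reals_iff)
      show "exp (Ln (- w) + \<i> * of_real pi) \<in> ball 0 r" if "w \<in> U2" for w
        using that nz[of w] by (auto simp: exp_add U2_def)
    qed
    moreover have "G w = w ^ M * \<phi> ((Ln (- w) + \<i> * of_real pi) / \<Lambda>)" if "w \<in> U2" for w
    proof -
      have "exp (Ln (- w) + \<i> * of_real pi) = w" using nz that by (simp add: exp_add)
      then show ?thesis
        using G_exp[of "Ln (- w) + \<i> * of_real pi"] that by (simp add: U2_def)
    qed
    ultimately have 2: "G holomorphic_on U2" by (simp cong: holomorphic_cong)
    have "ball 0 r - {0} = U1 \<union> U2"
      by (auto simp: U1_def U2_def complex_nonpos_Reals_iff complex_nonneg_Reals_iff complex_eq_iff)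
    then show ?thesis using holomorphic_on_Un[OF 1 2 open12] by simp
  qed
  have G_lim: "G \<midarrow>0\<rightarrow> 0"
  proof (rule Lim_null_comparison)
    define D where "D = C * exp (\<bar>A\<bar> * pi / \<bar>L\<bar>)"
    \<comment> \<open>The growth bound at any one point of the half-plane shows that its constant is nonnegative.\<close>
    have "norm (\<phi> (of_real \<bar>\<delta>\<bar> + 1)) \<le> C * exp (P * (\<bar>\<delta>\<bar> + 1))"
      using growth[of "of_real \<bar>\<delta>\<bar> + 1"] by simp
    then have "0 \<le> C * exp (P * (\<bar>\<delta>\<bar> + 1))" using norm_ge_zero order_trans by blast
    then have C: "0 \<le> C" by (simp add: zero_le_mult_iff)
    have "norm (G w) \<le> D * norm w powr (real M + P / L)" if w: "w \<noteq> 0" "norm w < r" for w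
    proof -
      have w0: "norm w > 0" using w by simp
      have "\<bar>Im (Ln w)\<bar> \<le> pi" using mpi_less_Im_Ln[OF w(1)] Im_Ln_le_pi[OF w(1)] by auto
      then have "\<bar>A\<bar> * \<bar>Im (Ln w)\<bar> / \<bar>L\<bar> \<le> \<bar>A\<bar> * pi / \<bar>L\<bar>"
        by (intro divide_right_mono mult_left_mono) auto
      moreover have "A * \<bar>Im (Ln w / \<Lambda>)\<bar> \<le> \<bar>A\<bar> * \<bar>Im (Ln w / \<Lambda>)\<bar>"
        by (intro mult_right_mono) auto
      moreover have "\<bar>Im (Ln w / \<Lambda>)\<bar> = \<bar>Im (Ln w)\<bar> / \<bar>L\<bar>" by (simp add: \<Lambda>_def)
      moreover have "Re (Ln w / \<Lambda>) = ln (norm w) / L" using w by (simp add: \<Lambda>_def)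
      ultimately have "P * Re (Ln w / \<Lambda>) + A * \<bar>Im (Ln w / \<Lambda>)\<bar>
          \<le> P * (ln (norm w) / L) + \<bar>A\<bar> * pi / \<bar>L\<bar>" by simp
      then have "C * exp (P * Re (Ln w / \<Lambda>) + A * \<bar>Im (Ln w / \<Lambda>)\<bar>)
          \<le> C * exp (P * (ln (norm w) / L) + \<bar>A\<bar> * pi / \<bar>L\<bar>)"
        using C by (intro mult_left_mono) auto
      moreover have "norm (\<phi> (Ln w / \<Lambda>)) \<le> C * exp (P * Re (Ln w / \<Lambda>) + A * \<bar>Im (Ln w / \<Lambda>)\<bar>)"
        by (rule growth, rule dom) (use w in simp)
      ultimately have "norm (\<phi> (Ln w / \<Lambda>)) \<le> C * exp (P * (ln (norm w) / L) + \<bar>A\<bar> * pi / \<bar>L\<bar>)"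
        by (rule order_trans[rotated])
      also have "\<dots> = D * norm w powr (P / L)"
        using w0 by (simp add: D_def exp_add powr_def mult_ac)
      finally have "norm w ^ M * norm (\<phi> (Ln w / \<Lambda>)) \<le> norm w ^ M * (D * norm w powr (P / L))"
        by (intro mult_left_mono) auto
      then show ?thesis using w0
        by (simp add: G_def norm_mult norm_power powr_add powr_realpow mult_ac)
    qed
    moreover have "\<forall>\<^sub>F w in at (0::complex). w \<noteq> 0 \<and> norm w < r"
      unfolding eventually_at using r0 by (intro exI[of _ r]) auto
    ultimately show "\<forall>\<^sub>F w in at 0. norm (G w) \<le> D * norm w powr (real M + P / L)"
      by (auto elim: eventually_mono)
    have "((\<lambda>w::complex. norm w powr (real M + P / L)) \<longlongrightarrow> 0 powr (real M + P / L)) (at 0)"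
      using M by (intro tendsto_powr' tendsto_norm_zero tendsto_ident_at tendsto_const) (auto intro!: always_eventually)
    then show "((\<lambda>w. D * norm w powr (real M + P / L)) \<longlongrightarrow> 0) (at (0::complex))"
      using tendsto_mult_right_zero by fastforce
  qed
  define G0 where "G0 w = (if w = 0 then 0 else G w)" for w
  have G0_holo: "G0 holomorphic_on ball 0 r"
    unfolding G0_def by (rule removable_singularity[OF G_holo open_ball G_lim])
  define b where "b n = (deriv ^^ n) G0 0 / fact n" for n
  have power_series: "(\<lambda>n. b n * w ^ n) sums G0 w" if "w \<in> ball 0 r" for w
    using holomorphic_power_series[OF G0_holo that] by (simp add: b_def)
  have term_eq: "b m * of_real (q powi (int m - int M)) powr z =
      b m * exp (z * \<Lambda>) ^ m / exp (z * \<Lambda>) ^ M" for m z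
  proof -
    have "of_real (q powi (int m - int M)) powr z = exp (z * \<Lambda>) powi (int m - int M)"
      using powr_of_real_powi[OF q(1)] q by (simp add: powr_def Ln_of_real \<Lambda>_def L_def)
    also have "\<dots> = exp (z * \<Lambda>) ^ m / exp (z * \<Lambda>) ^ M"
      by (simp add: power_int_diff)
    finally show ?thesis by simp
  qed
  have in_ball: "norm (exp (z * \<Lambda>)) < r" if "Re z > - \<delta>" for z
    using mult_strict_right_mono_neg[OF that L] by (simp add: r_def \<Lambda>_def)
  show thesis
  proof
    fix z :: complex assume z: "Re z > - \<delta>"
    define w where "w = exp (z * \<Lambda>)"
    have w: "norm w < r" "w \<noteq> 0" using in_ball[OF z] by (auto simp: w_def)
    obtain \<rho> where \<rho>: "norm w < \<rho>" "\<rho> < r" using dense w(1) by blast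
    have \<rho>0: "0 < \<rho>" using \<rho>(1) norm_ge_zero order_le_less_trans by blast
    have "summable (\<lambda>n. b n * of_real \<rho> ^ n)"
      using power_series[of "of_real \<rho>"] \<rho> \<rho>0 by (auto simp: sums_iff)
    then have "summable (\<lambda>n. norm (b n * w ^ n))"
      by (rule powser_insidea) (use \<rho> \<rho>0 in simp)
    then have "summable (\<lambda>n. norm (b n * w ^ n) / norm (w ^ M))" by (rule summable_divide)
    then show "summable (\<lambda>m. norm (b m * of_real (q powi (int m - int M)) powr z))"
      unfolding term_eq w_def[symmetric] norm_divide .
    have "(\<lambda>m. b m * w ^ m / w ^ M) sums (G0 w / w ^ M)"
      by (intro sums_divide power_series) (use w in simp)
    moreover have "G0 w = w ^ M * \<phi> z"
      using G_exp[of "z * \<Lambda>"] w \<Lambda>0 by (simp add: G0_def w_def)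
    ultimately show "(\<lambda>m. b m * of_real (q powi (int m - int M)) powr z) sums \<phi> z"
      unfolding term_eq w_def[symmetric] using w by simp
  qed
qed

section \<open>The Jackson integral\<close>

text \<open>Interchange the two summations. For fixed \<open>m\<close> the sum over \<open>n\<close> is the bilateral sum
  \<^term>\<open>S\<close> with its index shifted by \<open>m - M\<close>, and the shift contributes the factor
  \<open>x\<^bsup>M - m\<^esup>\<close>. The same computation with absolute values shows that the double series
  converges absolutely.\<close>

lemma jackson_sum_of_exponential_series:
  fixes b :: "nat \<Rightarrow> complex" and x :: complex and F :: "int \<Rightarrow> complex" and M :: nat
  assumes q: "0 < q" "q < 1" and x: "q < norm x" "norm x < 1"
    and S: "((\<lambda>n::int. x powi n / (1 + of_real q powi n)) has_sum S) UNIV"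
    and b_summable: "summable (\<lambda>m. norm (b m * x powi (int M - int m)))"
    and b_sums: "(\<lambda>m. b m * x powi (int M - int m)) sums B"
    and F: "\<And>n. (\<lambda>m. b m / (1 + of_real (q powi (n + int m - int M)))) sums F n"
  shows "((\<lambda>n. x powi n * F n) has_sum (B * S)) UNIV"
proof -
  have x0: "x \<noteq> 0" using x q by auto
  define h where "h m n = x powi n * (b m / (1 + of_real (q powi (n + int m - int M))))" for m :: nat and n :: int
  have h_eq: "h m n = b m * x powi (int M - int m) *
      (x powi (n + (int m - int M)) / (1 + of_real q powi (n + (int m - int M))))" for m n
  proof -
    have "x powi n = x powi (int M - int m) * x powi (n + (int m - int M))"
      using x0 by (simp flip: power_int_add)
    then show ?thesis by (simp add: h_def algebra_simps)
  qed
  have bij: "bij_betw (\<lambda>n. n + k) UNIV UNIV" for k :: int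
    by (rule bij_betwI[of _ _ _ "\<lambda>n. n - k"]) auto
  have shift: "((\<lambda>n. g (n + k)) has_sum T) UNIV" if "(g has_sum T) UNIV" for g :: "int \<Rightarrow> 'a::{comm_monoid_add,topological_space}" and T k
    using that has_sum_reindex_bij_betw[OF bij, of g k T] by simp
  have inner: "((\<lambda>n. h m n) has_sum (b m * x powi (int M - int m) * S)) UNIV" for m
    unfolding h_eq by (intro has_sum_cmult_right shift[OF S])
  obtain S' where S': "((\<lambda>n::int. norm x powi n / (1 + q powi n)) has_sum S') UNIV"
    using summable_bilateral[OF q(1) x] summable_on_def by blast
  have norm_h: "norm (h m n) = norm (b m * x powi (int M - int m)) *
      (norm x powi (n + (int m - int M)) / (1 + q powi (n + (int m - int M))))" for m n
  proof -
    have "norm (1 + complex_of_real q powi k) = 1 + q powi k" for k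
    proof -
      have "1 + complex_of_real q powi k = of_real (1 + q powi k)" by simp
      moreover have "0 < q powi k" using q by simp
      ultimately show ?thesis by (simp only: norm_of_real)
    qed
    then show ?thesis unfolding h_eq by (simp only: norm_mult norm_divide norm_power_int)
  qed
  have "(\<lambda>(m, n). norm (h m n)) summable_on (UNIV \<times> UNIV)"
  proof (rule summable_on_SigmaI)
    show "((\<lambda>n. case (m, n) of (m, n) \<Rightarrow> norm (h m n)) has_sum (norm (b m * x powi (int M - int m)) * S')) UNIV" for m
      unfolding prod.case norm_h by (intro has_sum_cmult_right shift[OF S'])
    show "(\<lambda>m. norm (b m * x powi (int M - int m)) * S') summable_on UNIV"
      by (intro summable_on_cmult_left norm_summable_imp_summable_on) (use b_summable in simp)
  qed auto
  then have sumh: "(\<lambda>(m, n). h m n) summable_on (UNIV \<times> UNIV)"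
    using abs_summable_summable[of "\<lambda>(m, n). h m n" "UNIV \<times> UNIV"] by (simp add: case_prod_unfold)
  have "((\<lambda>(m, n). h m n) has_sum (B * S)) (UNIV \<times> UNIV)"
  proof (rule has_sum_SigmaI)
    show "((\<lambda>n. case (m, n) of (m, n) \<Rightarrow> h m n) has_sum (b m * x powi (int M - int m) * S)) UNIV" for m
      using inner by simp
    show "((\<lambda>m. b m * x powi (int M - int m) * S) has_sum (B * S)) UNIV"
      by (intro has_sum_cmult_left norm_summable_imp_has_sum b_summable b_sums)
  qed (rule sumh)
  then have swapped: "((\<lambda>(n, m). h m n) has_sum (B * S)) (UNIV \<times> UNIV)"
    by (subst (asm) has_sum_swap) simp
  have "((\<lambda>m. h m n) has_sum (x powi n * F n)) UNIV" for n
  proof -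
    have "(\<lambda>(n, m). h m n) summable_on (UNIV \<times> UNIV)"
      using swapped by (auto simp: summable_on_def)
    then have "(\<lambda>m. h m n) summable_on UNIV"
      by (rule summable_on_SigmaD1[of "\<lambda>n m. h m n"]) simp
    moreover have "(\<lambda>m. h m n) sums (x powi n * F n)"
      unfolding h_def by (intro sums_mult F)
    ultimately show ?thesis
      using has_sum_imp_sums has_sum_infsum sums_unique2 by metis
  qed
  then show ?thesis
    by (intro has_sum_SigmaD[OF swapped]) simp
qed

text \<open>The right-hand side is the value of the bilateral sum at \<open>q\<^sup>s\<close>, times the factor
  \<open>1 - q\<close> of the Jackson integral: the two powers of \<open>1 - q\<close> in the gamma factors multiply
  to \<open>1 - q\<close>.\<close>

lemma q_Gamma_reflection_over_q_K:
  assumes q: "0 < q" "q < 1"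
  defines "x \<equiv> \<lambda>s. complex_of_real q powr s"
  shows "q_Gamma q s * q_Gamma q (1 - s) / q_K q s = of_real (1 - q) *
    (qpoch_inf (of_real q) q ^ 2 * qpoch_inf (- x s) q * qpoch_inf (- (of_real q / x s)) q /
       (qpoch_inf (x s) q * qpoch_inf (of_real q / x s) q * qpoch_inf (-1) q * qpoch_inf (- of_real q) q))"
proof -
  have powr_compl: "complex_of_real q powr (1 - s) = of_real q / x s"
    using q by (simp add: x_def powr_diff)
  have one: "complex_of_real (1 - q) powr (1 - s) * of_real (1 - q) powr (1 - (1 - s)) = of_real (1 - q)"
    using q powr_add[of "complex_of_real (1 - q)" "1 - s" s] by (simp del: of_real_diff)
  have regroup: "(g / a * u) * (g / b * v) = u * v * (g / a) * (g / b)" for g a b u v :: complex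
    by (simp add: divide_inverse mult_ac)
  have "q_Gamma q s * q_Gamma q (1 - s) = of_real (1 - q) *
     (qpoch_inf (of_real q) q / qpoch_inf (of_real q powr s) q) *
     (qpoch_inf (of_real q) q / qpoch_inf (of_real q powr (1 - s)) q)"
    unfolding q_Gamma_def regroup one ..
  then show ?thesis
    by (simp add: q_K_def powr_compl x_def power2_eq_square mult_ac)
qed

text \<open>Since \<open>0 < Re s < \<delta> < 1\<close>, the number \<open>q\<^sup>s\<close> lies in the annulus of the bilateral sum, and
  \<open>- s\<close> lies in the half-plane of the exponential expansion.\<close>

theorem theorem5:
  fixes q \<delta> A P C c :: real and \<phi> :: "complex \<Rightarrow> complex" and f :: "real \<Rightarrow> complex"
  assumes q: "0 < q" "q < 1"
    and \<delta>: "0 < \<delta>" "\<delta> < 1"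
    and analytic: "\<phi> analytic_on closed_right_half_plane \<delta>"
    and A: "A < pi"
    and growth: "\<And>z. z \<in> closed_right_half_plane \<delta> \<Longrightarrow>
                   norm (\<phi> z) < C * exp (P * Re z + A * \<bar>Im z\<bar>)"
    and periodic: "\<And>z. z \<in> closed_right_half_plane \<delta> \<Longrightarrow>
                   \<phi> (z + 2 * \<i> * of_real pi / of_real (ln q)) = \<phi> z"
    and f_series: "\<forall>\<^sub>F x in at_right 0. (\<lambda>k. \<phi> (of_nat k) * (- of_real x) ^ k) sums f x"
    and c: "0 < c" "c < \<delta>"
    and f_extension: "\<And>x. x > 0 \<Longrightarrow> f x = inverse_mellin \<phi> c x"
  shows "\<forall>s. 0 < Re s \<and> Re s < \<delta> \<longrightarrow>
           has_jackson_integral q (\<lambda>x. of_real x powr (s - 1) * f x)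
             (q_Gamma q s * q_Gamma q (1 - s) / q_K q s * \<phi> (- s))"
proof (intro allI impI)
  fix s :: complex assume s: "0 < Re s \<and> Re s < \<delta>"
  have "{z. Re z > - \<delta>} \<subseteq> closed_right_half_plane \<delta>"
    by (auto simp: closed_right_half_plane_def)
  then have holo: "\<phi> holomorphic_on {z. Re z > - \<delta>}"
    using analytic analytic_imp_holomorphic analytic_on_subset by blast
  obtain b M where
    b_summable: "\<And>z. Re z > - \<delta> \<Longrightarrow> summable (\<lambda>m. norm (b m * of_real (q powi (int m - int M)) powr z))"
    and b_sums: "\<And>z. Re z > - \<delta> \<Longrightarrow> (\<lambda>m. b m * of_real (q powi (int m - int M)) powr z) sums \<phi> z"
    by (rule periodic_exponential_expansion[OF q holo])
       (use growth periodic in \<open>auto simp: closed_right_half_plane_def intro!: less_imp_le\<close>)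
  have f_expansion: "(\<lambda>m. b m / (1 + of_real (q powi (n + int m - int M)))) sums f (q powi n)" for n
  proof -
    have "(\<lambda>m. b m / (1 + of_real (q powi n * q powi (int m - int M)))) sums inverse_mellin \<phi> c (q powi n)"
    proof (rule inverse_mellin_expansion)
      show "summable (\<lambda>m. norm (b m) * (q powi (int m - int M)) powr - c)"
        using b_summable[of "- of_real c"] c q by (simp add: norm_mult norm_powr_real_powr del: of_real_power_int)
      show "(\<lambda>m. b m * of_real (q powi (int m - int M)) powr - Complex c t) sums \<phi> (- Complex c t)" for t
        by (rule b_sums) (use c in simp)
    qed (use q \<delta> c in auto)
    then show ?thesis using q f_extension[of "q powi n"] by (simp add: power_int_add flip: add_diff_eq)
  qed
  define x where "x = complex_of_real q powr s"
  have "norm x = q powr Re s" using q by (simp add: x_def norm_powr_real_powr)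
  moreover have "q powr 1 < q powr Re s" "q powr Re s < q powr 0"
    using q s \<delta> by (intro powr_less_mono'; simp)+
  ultimately have x: "q < norm x" "norm x < 1" using q by simp_all
  have x0: "x \<noteq> 0" using x q by auto
  have powr_minus_s: "of_real (q powi (int m - int M)) powr (- s) = x powi (int M - int m)" for m
    using powr_of_real_powi[OF q(1), of "int m - int M" "- s"]
    by (simp add: x_def powr_minus power_int_inverse flip: power_int_minus)
  define S where "S = qpoch_inf (of_real q) q ^ 2 * qpoch_inf (-x) q * qpoch_inf (- (of_real q / x)) q /
             (qpoch_inf x q * qpoch_inf (of_real q / x) q * qpoch_inf (-1) q * qpoch_inf (- of_real q) q)"
  have "((\<lambda>n. x powi n * f (q powi n)) has_sum (\<phi> (- s) * S)) UNIV"
  proof (rule jackson_sum_of_exponential_series[OF q x _ _ _ f_expansion])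
    show "((\<lambda>n::int. x powi n / (1 + of_real q powi n)) has_sum S) UNIV"
      unfolding S_def by (rule ramanujan_bilateral_sum[OF q x])
    show "summable (\<lambda>m. norm (b m * x powi (int M - int m)))"
      using b_summable[of "- s"] s unfolding powr_minus_s by simp
    show "(\<lambda>m. b m * x powi (int M - int m)) sums \<phi> (- s)"
      using b_sums[of "- s"] s unfolding powr_minus_s by simp
  qed
  moreover have "x powi n * f (q powi n) =
      (of_real (q powi n) powr (s - 1) * f (q powi n)) * of_real (q powi n)" for n
  proof -
    have "of_real (q powi n) powr (s - 1) = x powi n / of_real (q powi n)"
      using powr_of_real_powi[OF q(1), of n s] q by (simp add: x_def powr_diff)
    then show ?thesis using q by simp
  qed
  ultimately have "((\<lambda>n. (of_real (q powi n) powr (s - 1) * f (q powi n)) * of_real (q powi n)) has_sum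
      (\<phi> (- s) * S)) UNIV" by simp
  moreover have "q_Gamma q s * q_Gamma q (1 - s) / q_K q s * \<phi> (- s) = of_real (1 - q) * (\<phi> (- s) * S)"
    using q_Gamma_reflection_over_q_K[OF q, of s] by (simp add: S_def x_def)
  ultimately show "has_jackson_integral q (\<lambda>x. of_real x powr (s - 1) * f x)
             (q_Gamma q s * q_Gamma q (1 - s) / q_K q s * \<phi> (- s))"
    unfolding has_jackson_integral_def by blast
qed

end
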